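(* For every integer $n\ge 1$, $$\mathcal{N}_{[n]\times[n]}(x)=\mathrm{Cat}(B_n,x)\qquad\text{and}\qquad \mathcal{N}_{[2n+1]\times K_n}(x)=\mathrm{Cat}(D_{2n+2},x).$$
   Context: $[m]$ denotes the chain with $m$ elements, and products of posets carry the componentwise order. $K_n=[n]\oplus([1]\sqcup[1])\oplus[n]$, where $\sqcup$ is disjoint union and $\oplus$ is ordinal sum (in $R\oplus S$ every element of $R$ is below every element of $S$). For a finite poset $R$, $\mathcal{N}_R(x):=\sum_A x^{|A|}$, where $A$ runs over all antichains of $R$ (including the empty one). $\mathrm{Cat}(B_n,x)$ and $\mathrm{Cat}(D_N,x)$ are the Narayana polynomials of types $B_n$ and $D_N$, given explicitly by $$\mathrm{Cat}(B_n,x)=\sum_{i=0}^n\binom{n}{i}^2x^i,\qquad \mathrm{Cat}(D_N,x)=\sum_{i=0}^{N}\binom{N}{i}\left(\binom{N-1}{i}+\binom{N-2}{i-2}\right)x^i,$$ where binomial coefficients $\binom{a}{b}$ with $b<0$ or $b>a$ are $0$. *)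

theory Defs
  imports "HOL-Computational_Algebra.Polynomial"
begin

text \<open>
  A poset is given by its reflexive order relation \<open>r\<close>, as in \<open>Partial_order r\<close>; the underlying
  set is \<open>Field r\<close>. The chain with \<open>m\<close> elements is the library's \<open>natLeq_on m\<close>, that is, the
  usual order on \<open>{0, \<dots>, m - 1}\<close>.
\<close>

definition poset_prod :: "'a rel \<Rightarrow> 'b rel \<Rightarrow> ('a \<times> 'b) rel" (infixr \<open>\<times>\<^sub>P\<close> 80)
  where "r \<times>\<^sub>P s = {((a, b), (a', b')) | a b a' b'. (a, a') \<in> r \<and> (b, b') \<in> s}"

definition disjoint_union :: "'a rel \<Rightarrow> 'b rel \<Rightarrow> ('a + 'b) rel" (infixl \<open>\<squnion>\<^sub>P\<close> 65)
  where "r \<squnion>\<^sub>P s = {(Inl a, Inl a') | a a'. (a, a') \<in> r} \<union> {(Inr b, Inr b') | b b'. (b, b') \<in> s}"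

definition ordinal_sum :: "'a rel \<Rightarrow> 'b rel \<Rightarrow> ('a + 'b) rel" (infixl \<open>\<oplus>\<^sub>P\<close> 65)
  where "r \<oplus>\<^sub>P s = (r \<squnion>\<^sub>P s) \<union> {(Inl a, Inr b) | a b. a \<in> Field r \<and> b \<in> Field s}"

definition poset_K :: "nat \<Rightarrow> ((nat + (nat + nat)) + nat) rel"
  where "poset_K n = natLeq_on n \<oplus>\<^sub>P (natLeq_on 1 \<squnion>\<^sub>P natLeq_on 1) \<oplus>\<^sub>P natLeq_on n"

definition antichain :: "'a rel \<Rightarrow> 'a set \<Rightarrow> bool"
  where "antichain r A \<longleftrightarrow> A \<subseteq> Field r \<and> (\<forall>a\<in>A. \<forall>b\<in>A. a \<noteq> b \<longrightarrow> (a, b) \<notin> r)"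

text \<open>The sum below ranges over a finite set whenever \<open>Field r\<close> is finite.\<close>

definition antichain_poly :: "'a rel \<Rightarrow> int poly"
  where "antichain_poly r = (\<Sum>A | antichain r A. monom 1 (card A))"

definition Cat_B :: "nat \<Rightarrow> int poly"
  where "Cat_B n = (\<Sum>i\<le>n. monom (int ((n choose i)\<^sup>2)) i)"

text \<open>
  The case distinction implements the convention that a binomial coefficient with negative lower
  entry is \<open>0\<close>, which truncated subtraction in \<open>i - 2\<close> would violate. Type \<open>D\<^sub>N\<close> is
  meant for \<open>N \<ge> 2\<close>, where \<open>N - 1\<close> and \<open>N - 2\<close> do not truncate.
\<close>

definition Cat_D :: "nat \<Rightarrow> int poly"
  where "Cat_D N = (\<Sum>i\<le>N. monom (int ((N choose i) *
    (((N - 1) choose i) + (if i < 2 then 0 else (N - 2) choose (i - 2))))) i)"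

lemma Partial_order_iff:
  "Partial_order r \<longleftrightarrow> (\<forall>x y. (x, y) \<in> r \<longrightarrow> (x, x) \<in> r \<and> (y, y) \<in> r) \<and> trans r \<and> antisym r"
proof -
  have "(\<forall>x\<in>Field r. (x, x) \<in> r) \<longleftrightarrow> (\<forall>x y. (x, y) \<in> r \<longrightarrow> (x, x) \<in> r \<and> (y, y) \<in> r)"
    unfolding Field_def by blast
  moreover have "r \<subseteq> Field r \<times> Field r"
    by (auto intro: FieldI1 FieldI2)
  ultimately show ?thesis
    unfolding partial_order_on_def preorder_on_def refl_on_def by simp
qed

lemma Partial_order_natLeq_on: "Partial_order (natLeq_on m)"
  unfolding Partial_order_iff by (auto simp: trans_def antisym_def)

lemma poset_prod_iff [simp]:
  "((a, b), (a', b')) \<in> r \<times>\<^sub>P s \<longleftrightarrow> (a, a') \<in> r \<and> (b, b') \<in> s"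
  by (simp add: poset_prod_def)

lemma disjoint_union_iff [simp]:
  "(Inl a, Inl a') \<in> r \<squnion>\<^sub>P s \<longleftrightarrow> (a, a') \<in> r"
  "(Inr b, Inr b') \<in> r \<squnion>\<^sub>P s \<longleftrightarrow> (b, b') \<in> s"
  "(Inl a, Inr b) \<notin> r \<squnion>\<^sub>P s"
  "(Inr b, Inl a) \<notin> r \<squnion>\<^sub>P s"
  by (simp_all add: disjoint_union_def)

lemma ordinal_sum_iff [simp]:
  "(Inl a, Inl a') \<in> r \<oplus>\<^sub>P s \<longleftrightarrow> (a, a') \<in> r"
  "(Inr b, Inr b') \<in> r \<oplus>\<^sub>P s \<longleftrightarrow> (b, b') \<in> s"
  "(Inl a, Inr b) \<in> r \<oplus>\<^sub>P s \<longleftrightarrow> a \<in> Field r \<and> b \<in> Field s"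
  "(Inr b, Inl a) \<notin> r \<oplus>\<^sub>P s"
  by (simp_all add: ordinal_sum_def)

lemma in_Field_iff: "Partial_order r \<Longrightarrow> x \<in> Field r \<longleftrightarrow> (x, x) \<in> r"
  by (auto simp: partial_order_on_def preorder_on_def refl_on_def intro: FieldI1)

lemma Partial_order_I:
  assumes "\<And>x y. (x, y) \<in> r \<Longrightarrow> (x, x) \<in> r \<and> (y, y) \<in> r"
    and "\<And>x y z. (x, y) \<in> r \<Longrightarrow> (y, z) \<in> r \<Longrightarrow> (x, z) \<in> r"
    and "\<And>x y. (x, y) \<in> r \<Longrightarrow> (y, x) \<in> r \<Longrightarrow> x = y"
  shows "Partial_order r"
  unfolding Partial_order_iff using assms by (auto intro: transI antisymI)

lemma Partial_order_D:
  assumes "Partial_order r"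
  shows "(x, y) \<in> r \<Longrightarrow> (x, x) \<in> r" "(x, y) \<in> r \<Longrightarrow> (y, y) \<in> r"
    "(x, y) \<in> r \<Longrightarrow> (y, z) \<in> r \<Longrightarrow> (x, z) \<in> r"
    "(x, y) \<in> r \<Longrightarrow> (y, x) \<in> r \<Longrightarrow> x = y"
  using assms unfolding Partial_order_iff by (blast dest: transD antisymD)+

lemma Partial_order_poset_prod:
  assumes "Partial_order r" "Partial_order s"
  shows "Partial_order (r \<times>\<^sub>P s)"
proof (rule Partial_order_I, goal_cases)
  case (1 x y)
  then show ?case
    by (cases x; cases y) (auto dest: Partial_order_D[OF assms(1)] Partial_order_D[OF assms(2)])
next
  case (2 x y z)
  then show ?case
    by (cases x; cases y; cases z) (auto dest: Partial_order_D[OF assms(1)] Partial_order_D[OF assms(2)])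
next
  case (3 x y)
  then show ?case
    by (cases x; cases y) (auto dest: Partial_order_D[OF assms(1)] Partial_order_D[OF assms(2)])
qed

lemma Field_poset_prod:
  assumes "Partial_order r" "Partial_order s"
  shows "Field (r \<times>\<^sub>P s) = Field r \<times> Field s"
  by (simp add: set_eq_iff in_Field_iff assms Partial_order_poset_prod)

lemma Partial_order_disjoint_union:
  assumes "Partial_order r" "Partial_order s"
  shows "Partial_order (r \<squnion>\<^sub>P s)"
proof (rule Partial_order_I, goal_cases)
  case (1 x y)
  then show ?case
    by (cases x; cases y) (auto dest: Partial_order_D[OF assms(1)] Partial_order_D[OF assms(2)])
next
  case (2 x y z)
  then show ?case
    by (cases x; cases y; cases z) (auto dest: Partial_order_D[OF assms(1)] Partial_order_D[OF assms(2)])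
next
  case (3 x y)
  then show ?case
    by (cases x; cases y) (auto dest: Partial_order_D[OF assms(1)] Partial_order_D[OF assms(2)])
qed

lemma Field_disjoint_union:
  assumes "Partial_order r" "Partial_order s"
  shows "Field (r \<squnion>\<^sub>P s) = Field r <+> Field s"
  by (simp add: set_eq_iff split_sum_all in_Field_iff assms Partial_order_disjoint_union Plus_def
      image_iff)

lemma Partial_order_ordinal_sum:
  assumes "Partial_order r" "Partial_order s"
  shows "Partial_order (r \<oplus>\<^sub>P s)"
proof (rule Partial_order_I, goal_cases)
  case (1 x y)
  then show ?case
    by (cases x; cases y) (auto dest: Partial_order_D[OF assms(1)] Partial_order_D[OF assms(2)]
        simp: in_Field_iff assms)
next
  case (2 x y z)
  then show ?case
    by (cases x; cases y; cases z) (auto dest: Partial_order_D[OF assms(1)] Partial_order_D[OF assms(2)]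
        simp: in_Field_iff assms)
next
  case (3 x y)
  then show ?case
    by (cases x; cases y) (auto dest: Partial_order_D[OF assms(1)] Partial_order_D[OF assms(2)]
        simp: in_Field_iff assms)
qed

lemma Field_ordinal_sum:
  assumes "Partial_order r" "Partial_order s"
  shows "Field (r \<oplus>\<^sub>P s) = Field r <+> Field s"
  by (simp add: set_eq_iff split_sum_all in_Field_iff assms Partial_order_ordinal_sum Plus_def
      image_iff)

lemma Partial_order_poset_K: "Partial_order (poset_K n)"
  unfolding poset_K_def
  by (intro Partial_order_ordinal_sum Partial_order_disjoint_union Partial_order_natLeq_on)

lemma finite_antichains: "finite (Field r) \<Longrightarrow> finite {A. antichain r A}"
  by (rule finite_subset[of _ "Pow (Field r)"]) (auto simp: antichain_def)

end

(*
  A product of chains of sizes m and c has (m choose k) * (c choose k) antichains of size k. The poset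
  K_n is a chain except for one incomparable pair of adjacent elements a, b, so an antichain of
  [m] x K_n either is an antichain for one of the two linear extensions of K_n, or it contains (i, a)
  and (i, b) for some i and is determined by what remains after removing (i, b). Inclusion-exclusion
  reduces the second identity to the first count and Pascal's rule.
*)

theory Submission
  imports Defs
begin

section \<open>Size polynomials of set families, and antichains of a product with a linear
  order\<close>

definition card_poly :: "'a set set \<Rightarrow> int poly"
  where "card_poly F = (\<Sum>A\<in>F. monom 1 (card A))"

text \<open>Both index sets and the comparison on the second factor are separate parameters, so that
  the sets can shrink in an induction and antichains for different orders on the same
  \<open>Y\<close> can be intersected.\<close>

definition prod_antichains :: "('b \<Rightarrow> 'b \<Rightarrow> bool) \<Rightarrow> 'a::linorder set \<Rightarrow> 'b set \<Rightarrow> ('a \<times> 'b) set set"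
  where "prod_antichains le X Y = {A. A \<subseteq> X \<times> Y \<and>
    (\<forall>p\<in>A. \<forall>q\<in>A. p \<noteq> q \<longrightarrow> \<not> (fst p \<le> fst q \<and> le (snd p) (snd q)))}"

abbreviation rank_le :: "('b \<Rightarrow> nat) \<Rightarrow> 'b \<Rightarrow> 'b \<Rightarrow> bool"
  where "rank_le g \<equiv> (\<lambda>y y'. g y \<le> g y')"

text \<open>An antichain of size \<open>k\<close> in a product of two chains picks \<open>k\<close>
  elements from each chain and pairs them in opposite orders, whence the product of
  binomials.\<close>

abbreviation prod_chains_coeff :: "nat \<Rightarrow> nat \<Rightarrow> nat \<Rightarrow> int"
  where "prod_chains_coeff m c k \<equiv> int ((m choose k) * (c choose k))"

lemma card_poly_Un:
  assumes "finite F" "finite G"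
  shows "card_poly (F \<union> G) = card_poly F + card_poly G - card_poly (F \<inter> G)"
  unfolding card_poly_def using sum_Un[OF assms] by simp

lemma card_poly_Un_disjoint:
  assumes "finite F" "finite G" "F \<inter> G = {}"
  shows "card_poly (F \<union> G) = card_poly F + card_poly G"
  unfolding card_poly_def using sum.union_disjoint[OF assms] by simp

lemma card_poly_Diff:
  assumes "finite F" "G \<subseteq> F"
  shows "card_poly (F - G) = card_poly F - card_poly G"
  unfolding card_poly_def using sum_diff[OF assms] by simp

text \<open>Enlarging every set of a family by one element multiplies its polynomial by the
  variable, which is what \<open>pCons 0\<close> expresses.\<close>

lemma card_poly_image_Suc:
  assumes "inj_on f F" "\<And>A. A \<in> F \<Longrightarrow> card (f A) = Suc (card A)"
  shows "card_poly (f ` F) = pCons 0 (card_poly F)"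
proof -
  have "card_poly (f ` F) = (\<Sum>A\<in>F. monom 1 1 * monom 1 (card A))"
    unfolding card_poly_def by (simp add: sum.reindex[OF assms(1)] assms(2) mult_monom)
  also have "\<dots> = monom 1 1 * card_poly F"
    by (simp only: card_poly_def sum_distrib_left)
  finally show ?thesis
    by (simp add: monom_Suc)
qed

lemma prod_antichainsI:
  assumes "A \<subseteq> X \<times> Y"
    and "\<And>i y j z. (i, y) \<in> A \<Longrightarrow> (j, z) \<in> A \<Longrightarrow> (i, y) \<noteq> (j, z) \<Longrightarrow> i \<le> j \<Longrightarrow> \<not> le y z"
  shows "A \<in> prod_antichains le X Y"
  using assms unfolding prod_antichains_def by fastforce

lemma prod_antichainsD:
  assumes "A \<in> prod_antichains le X Y" "(i, y) \<in> A" "(j, z) \<in> A" "i \<le> j" "le y z"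
  shows "i = j \<and> y = z"
  using assms unfolding prod_antichains_def by fastforce

lemma not_prod_antichainsE:
  assumes "A \<notin> prod_antichains le X Y" "A \<subseteq> X \<times> Y"
  obtains i y j z where "(i, y) \<in> A" "(j, z) \<in> A" "(i, y) \<noteq> (j, z)" "i \<le> j" "le y z"
  using prod_antichainsI[OF assms(2), of le] assms(1) by blast

lemma prod_antichains_subset: "A \<in> prod_antichains le X Y \<Longrightarrow> A \<subseteq> X \<times> Y"
  by (simp add: prod_antichains_def)

lemma finite_prod_antichains:
  "finite X \<Longrightarrow> finite Y \<Longrightarrow> finite (prod_antichains le X Y)"
  by (rule finite_subset[of _ "Pow (X \<times> Y)"]) (auto simp: prod_antichains_def)

lemma finite_of_prod_antichains:
  "A \<in> prod_antichains le X Y \<Longrightarrow> finite X \<Longrightarrow> finite Y \<Longrightarrow> finite A"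
  by (rule finite_subset[OF prod_antichains_subset]) auto

lemma prod_antichains_empty [simp]:
  "prod_antichains le {} Y = {{}}" "prod_antichains le X {} = {{}}"
  by (auto simp: prod_antichains_def)

lemma prod_antichains_Int:
  "prod_antichains le X Y \<inter> prod_antichains le X' Y' = prod_antichains le (X \<inter> X') (Y \<inter> Y')"
  by (auto simp: prod_antichains_def)

lemma prod_antichains_mono:
  "X \<subseteq> X' \<Longrightarrow> Y \<subseteq> Y' \<Longrightarrow> prod_antichains le X Y \<subseteq> prod_antichains le X' Y'"
  by (auto simp: prod_antichains_def)

section \<open>The product of two chains\<close>

text \<open>
  The corner \<open>(x, y)\<close> is incomparable to all of \<open>X \<times> Y\<close>, whereas every element of its column
  lies below every element of its row.
\<close>

lemma prod_antichains_insert_insert: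
  assumes x: "\<And>i. i \<in> X \<Longrightarrow> x < i" and y: "\<And>z. z \<in> Y \<Longrightarrow> g z < g y"
  shows "prod_antichains (rank_le g) (insert x X) (insert y Y) =
    (prod_antichains (rank_le g) X (insert y Y) \<union> prod_antichains (rank_le g) (insert x X) Y)
    \<union> insert (x, y) ` prod_antichains (rank_le g) X Y" (is "?L = ?R1 \<union> ?R2 \<union> insert _ ` ?R3")
proof (intro equalityI subsetI)
  fix A assume A: "A \<in> ?L"
  note sub = prod_antichains_subset[OF A] and D = prod_antichainsD[OF A]
  show "A \<in> ?R1 \<union> ?R2 \<union> insert (x, y) ` ?R3"
  proof (cases "(x, y) \<in> A")
    case True
    \<comment> \<open>An element \<open>(x, z)\<close> of the column lies below the corner and an
      element \<open>(i, y)\<close> of the row lies above it, so an antichain through the corner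
      contains neither.\<close>
    have "A - {(x, y)} \<subseteq> X \<times> Y"
    proof
      fix p assume p: "p \<in> A - {(x, y)}"
      obtain i z where [simp]: "p = (i, z)" by (cases p)
      have "i \<noteq> x"
      proof
        assume "i = x"
        then have "z \<in> Y" using p sub by auto
        then show False using D[of i z x y] p True y[of z] \<open>i = x\<close> by auto
      qed
      moreover have "z \<noteq> y"
      proof
        assume "z = y"
        then have "i \<in> X" using p sub by auto
        then show False using D[of x y i z] p True x[of i] \<open>z = y\<close> by (auto simp: less_imp_le)
      qed
      ultimately show "p \<in> X \<times> Y" using p sub by auto
    qed
    then have "A - {(x, y)} \<in> ?R3"
      using D by (intro prod_antichainsI) auto
    moreover have "A = insert (x, y) (A - {(x, y)})" using True by auto
    ultimately show ?thesis by blast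
  next
    case False
    \<comment> \<open>Column elements lie below row elements, so an antichain without the corner
      misses the column or the row.\<close>
    have "A \<subseteq> X \<times> insert y Y \<or> A \<subseteq> insert x X \<times> Y"
    proof (rule ccontr)
      assume "\<not> ?thesis"
      then have "\<exists>z. (x, z) \<in> A" "\<exists>i. (i, y) \<in> A" using sub by blast+
      then obtain z i where "(x, z) \<in> A" "(i, y) \<in> A" by blast
      moreover from this have "z \<in> Y" "i \<in> X" using sub False by auto
      ultimately show False using D[of x z i y] x[of i] y[of z] by auto
    qed
    then show ?thesis using A by (auto simp: prod_antichains_def)
  qed
next
  fix A assume "A \<in> ?R1 \<union> ?R2 \<union> insert (x, y) ` ?R3"
  then consider "A \<in> ?R1 \<union> ?R2" | B where "B \<in> ?R3" "A = insert (x, y) B" by blast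
  then show "A \<in> ?L"
  proof cases
    case 1
    then show ?thesis by (auto simp: prod_antichains_def)
  next
    case 2
    note sub = prod_antichains_subset[OF 2(1)] and D = prod_antichainsD[OF 2(1)]
    show ?thesis
    proof (rule prod_antichainsI)
      show "A \<subseteq> insert x X \<times> insert y Y" using sub 2 by auto
    next
      fix i z j w
      assume "(i, z) \<in> A" "(j, w) \<in> A" "(i, z) \<noteq> (j, w)" "i \<le> j"
      then consider "(i, z) \<in> B" "(j, w) \<in> B" | "(i, z) = (x, y)" "(j, w) \<in> B"
        | "(i, z) \<in> B" "(j, w) = (x, y)"
        using 2 by auto
      then show "\<not> g z \<le> g w"
      proof cases
        case 1
        then show ?thesis using D[of i z j w] \<open>i \<le> j\<close> \<open>(i, z) \<noteq> (j, w)\<close> by auto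
      next
        case c: 2
        then show ?thesis using y[of w] sub by auto
      next
        case 3
        then show ?thesis using x[of i] sub \<open>i \<le> j\<close> by auto
      qed
    qed
  qed
qed

text \<open>Nested induction: \<open>Y\<close> grows by an element of highest rank, \<open>X\<close>
  by a least element. Inclusion-exclusion on the corner decomposition gives the recurrence
  \<open>eq\<close>, which the products of binomials satisfy by Pascal's rule in both
  factors.\<close>

lemma coeff_card_poly_rank:
  assumes "finite Y" "finite X" "inj_on g Y"
  shows "coeff (card_poly (prod_antichains (rank_le g) X Y)) k =
    prod_chains_coeff (card X) (card Y) k"
  using assms
proof (induction Y arbitrary: X k rule: finite_ranking_induct[where f = g])
  case empty
  then show ?case by (simp add: card_poly_def)
next
  case (insert y Y)
  \<comment> \<open>The induction makes the rank of \<open>y\<close> only weakly maximal and allows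
    \<open>y\<close> to lie in \<open>Y\<close> already; for a new \<open>y\<close>, injectivity of
    \<open>g\<close> gives strictness.\<close>
  show ?case
  proof (cases "y \<in> Y")
    case True
    then show ?thesis using insert by (simp add: insert_absorb)
  next
    case False
    have inj: "inj_on g Y" using insert.prems(2) by (auto simp: inj_on_def)
    have y: "g z < g y" if "z \<in> Y" for z
      using that insert.hyps(2)[OF that] insert.prems(2) False
      by (metis inj_onD insertCI order_le_less)
    note IH = insert.IH
    from insert.prems(1) show ?thesis
    proof (induction X arbitrary: k rule: finite_linorder_min_induct)
      case empty
      then show ?case by (simp add: card_poly_def)
    next
      case (insert x X)
      let ?P = "\<lambda>X Y. prod_antichains (rank_le g) X Y"
      have x: "x < i" if "i \<in> X" for i using insert.hyps that by auto
      have xX: "x \<notin> X" using x by blast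
      note fin = finite_prod_antichains[of _ _ "rank_le g"]
      have [simp]: "finite X" "finite Y" using insert.hyps \<open>finite Y\<close> by auto
      have "card_poly (insert (x, y) ` ?P X Y) = pCons 0 (card_poly (?P X Y))"
      proof (rule card_poly_image_Suc)
        show "inj_on (insert (x, y)) (?P X Y)"
          using xX by (intro inj_onI) (metis insert_ident mem_Sigma_iff prod_antichains_subset subsetD)
        show "card (insert (x, y) A) = Suc (card A)" if "A \<in> ?P X Y" for A
          using prod_antichains_subset[OF that] finite_of_prod_antichains[OF that] xX
          by (subst card_insert_disjoint) auto
      qed
      \<comment> \<open>Only the sets in the image contain the corner, since \<open>x\<close> is
        outside \<open>X\<close> and \<open>y\<close> outside \<open>Y\<close>.\<close>
      moreover have "(?P X (insert y Y) \<union> ?P (insert x X) Y) \<inter> insert (x, y) ` ?P X Y = {}"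
        using xX False by (auto simp: prod_antichains_def)
      moreover have "?P X (insert y Y) \<inter> ?P (insert x X) Y = ?P X Y"
        unfolding prod_antichains_Int using False xX by (intro arg_cong2[where f = ?P]) auto
      ultimately have eq: "card_poly (?P (insert x X) (insert y Y)) =
        card_poly (?P X (insert y Y)) + card_poly (?P (insert x X) Y) - card_poly (?P X Y)
        + pCons 0 (card_poly (?P X Y))"
        by (simp add: card_poly_Un_disjoint
            prod_antichains_insert_insert[where g = g and x = x and X = X and y = y and Y = Y, OF x y]
            card_poly_Un fin)
      show ?case
        unfolding eq using xX False inj
        by (cases k) (simp_all add: IH insert.IH algebra_simps)
    qed
  qed
qed

section \<open>A chain with two adjacent elements made incomparable\<close>

text \<open>If \<open>b\<close> has the rank right after \<open>a\<close>, nothing lies strictly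
  between them, so deleting this one relation keeps transitivity on a set where \<open>g\<close> is
  injective.\<close>

definition twin_le :: "('b \<Rightarrow> nat) \<Rightarrow> 'b \<Rightarrow> 'b \<Rightarrow> 'b \<Rightarrow> 'b \<Rightarrow> bool"
  where "twin_le g a b y z \<longleftrightarrow> g y \<le> g z \<and> \<not> (y = a \<and> z = b)"

text \<open>
  The linear extensions are the orders by \<open>g\<close> and by \<open>h\<close>, which exchanges the ranks of \<open>a\<close> and \<open>b\<close>.
  An antichain for both of them avoids \<open>a\<close> or \<open>b\<close>.
\<close>

lemma coeff_card_poly_twin:
  fixes X :: "'a::linorder set"
  assumes Y: "finite Y" and X: "finite X" and g: "inj_on g Y"
    and a: "a \<in> Y" and b: "b \<in> Y" and ab: "g b = Suc (g a)" and cY: "card Y = Suc (Suc c)"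
  shows "coeff (card_poly (prod_antichains (twin_le g a b) X Y)) k =
    2 * prod_chains_coeff (card X) (c + 2) k - 2 * prod_chains_coeff (card X) (c + 1) k
    + prod_chains_coeff (card X) c k
    + (if k = 0 then 0
       else prod_chains_coeff (card X) (c + 1) (k - 1) - prod_chains_coeff (card X) c (k - 1))"
proof -
  let ?P = "prod_antichains (rank_le g) X"
  define h where "h = g(a := g b, b := g a)"
  let ?H = "prod_antichains (rank_le h) X"
  let ?F = "prod_antichains (twin_le g a b) X Y"
  \<comment> \<open>\<open>?f\<close> puts \<open>(i, b)\<close> beside every \<open>(i, a)\<close>.
    It is applied to \<open>?D\<close>, the antichains that avoid \<open>b\<close> but use
    \<open>a\<close>, and reverses the removal of \<open>(i, b)\<close>.\<close>
  let ?f = "\<lambda>A. A \<union> (\<lambda>i. (i, b)) ` {i. (i, a) \<in> A}"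
  let ?D = "?P (Y - {b}) - ?P (Y - {a, b})"
  have neq: "a \<noteq> b" using ab by auto
  have fin [simp]: "finite (prod_antichains le X Z)" if "Z \<subseteq> Y" for Z le
    using finite_subset[OF that Y] X by (simp add: finite_prod_antichains)
  have hab: "g a \<le> g b" "h b \<le> h a" using ab neq by (simp_all add: h_def)
  have h: "inj_on h Y"
  proof (rule inj_onI)
    fix y z assume "y \<in> Y" "z \<in> Y" "h y = h z"
    then show "y = z"
      using inj_on_eq_iff[OF g, of y z] inj_on_eq_iff[OF g, of a z] inj_on_eq_iff[OF g, of b z]
        inj_on_eq_iff[OF g, of y a] inj_on_eq_iff[OF g, of y b] a b ab
      by (simp add: h_def split: if_splits)
  qed
  \<comment> \<open>The ranks of \<open>a\<close> and \<open>b\<close> are consecutive, so every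
    other element compares with both in the same way.\<close>
  have twin: "g y \<le> g a \<longleftrightarrow> g y \<le> g b" "g a \<le> g y \<longleftrightarrow> g b \<le> g y"
    if "y \<in> Y" "y \<noteq> a" "y \<noteq> b" for y
  proof -
    have "g y \<noteq> g a" "g y \<noteq> g b" using g that a b by (meson inj_onD)+
    then show "g y \<le> g a \<longleftrightarrow> g y \<le> g b" "g a \<le> g y \<longleftrightarrow> g b \<le> g y" using ab by auto
  qed
  \<comment> \<open>Each linear extension adds exactly one relation to the twin order:
    \<open>b\<close> below \<open>a\<close> for \<open>h\<close>, \<open>a\<close> below
    \<open>b\<close> for \<open>g\<close>.\<close>
  have twin_h: "h y \<le> h z \<longleftrightarrow> twin_le g a b y z \<or> y = b \<and> z = a" if "y \<in> Y" "z \<in> Y" for y z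
    using twin[OF that(1)] twin[OF that(2)] ab neq by (auto simp: h_def twin_le_def)
  have twin_g: "g y \<le> g z \<longleftrightarrow> twin_le g a b y z \<or> y = a \<and> z = b" for y z
    using ab by (auto simp: twin_le_def)

  have PF: "?P Y \<subseteq> ?F"
    using twin_g unfolding prod_antichains_def by blast
  have HF: "?H Y \<subseteq> ?F"
  proof
    fix A assume A: "A \<in> ?H Y"
    from prod_antichains_subset[OF A] prod_antichainsD[OF A] show "A \<in> ?F"
      using twin_h by (intro prod_antichainsI) blast+
  qed
  have PH: "?P Y \<inter> ?H Y = ?P (Y - {a}) \<union> ?P (Y - {b})"
  proof (intro equalityI subsetI)
    fix A assume A: "A \<in> ?P Y \<inter> ?H Y"
    then have sub: "A \<subseteq> X \<times> Y" by (auto dest: prod_antichains_subset)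
    \<comment> \<open>If \<open>i \<le> j\<close>, the order by \<open>g\<close> makes the two pairs
      comparable; otherwise the order by \<open>h\<close> does.\<close>
    have "\<not> ((i, a) \<in> A \<and> (j, b) \<in> A)" for i j
    proof (cases "i \<le> j")
      case True
      then show ?thesis using A prod_antichainsD[of A "rank_le g" X Y i a j b] hab neq by blast
    next
      case False
      then have "j \<le> i" by simp
      then show ?thesis using A prod_antichainsD[of A "rank_le h" X Y j b i a] hab neq by blast
    qed
    then have "A \<subseteq> X \<times> (Y - {a}) \<or> A \<subseteq> X \<times> (Y - {b})" using sub by blast
    then show "A \<in> ?P (Y - {a}) \<union> ?P (Y - {b})" using A by (auto simp: prod_antichains_def)
  next
    fix A assume A: "A \<in> ?P (Y - {a}) \<union> ?P (Y - {b})"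
    then have P: "A \<in> ?P Y" by (auto simp: prod_antichains_def)
    have "A \<in> ?H Y"
    proof (rule prod_antichainsI)
      show sub: "A \<subseteq> X \<times> Y" using P by (rule prod_antichains_subset)
      fix i y j z assume *: "(i, y) \<in> A" "(j, z) \<in> A" "(i, y) \<noteq> (j, z)" "i \<le> j"
      \<comment> \<open>Avoiding \<open>a\<close> or \<open>b\<close> excludes the only relation
        that the order by \<open>h\<close> adds to the twin order.\<close>
      have "\<not> (y = b \<and> z = a)" using A * by (auto dest!: prod_antichains_subset)
      moreover have "\<not> g y \<le> g z" using prod_antichainsD[OF P *(1,2,4)] *(3) by auto
      ultimately show "\<not> h y \<le> h z" using twin_h[of y z] twin_g[of y z] * sub by auto
    qed
    then show "A \<in> ?P Y \<inter> ?H Y" using P by simp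
  qed
  have f_inter: "?f A \<inter> X \<times> (Y - {b}) = A" if "A \<in> ?D" for A
    using that neq by (auto dest!: prod_antichains_subset)
  have F: "?F = (?P Y \<union> ?H Y) \<union> ?f ` ?D"
  proof (intro equalityI subsetI)
    fix A assume A: "A \<in> ?F"
    note sub = prod_antichains_subset[OF A] and D = prod_antichainsD[OF A]
    show "A \<in> (?P Y \<union> ?H Y) \<union> ?f ` ?D"
    proof (cases "A \<in> ?P Y \<union> ?H Y")
      case False
      then have "A \<notin> ?P Y" "A \<notin> ?H Y" by auto
      \<comment> \<open>Failure for each linear extension must come from the relation it adds. This
        yields \<open>(i, a)\<close>, \<open>(j, b)\<close> with \<open>i \<le> j\<close>, and
        \<open>(i', b)\<close>, \<open>(j', a)\<close> with \<open>i' \<le> j'\<close>.\<close>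
      obtain i y j z where ij: "(i, y) \<in> A" "(j, z) \<in> A" "(i, y) \<noteq> (j, z)" "i \<le> j" "g y \<le> g z"
        using \<open>A \<notin> ?P Y\<close> sub by (rule not_prod_antichainsE)
      have "y = a" "z = b" using D[OF ij(1,2,4)] ij(3,5) twin_g[of y z] by auto
      with ij have 1: "(i, a) \<in> A" "(j, b) \<in> A" "i \<le> j" by auto
      obtain i' y' j' z' where ij': "(i', y') \<in> A" "(j', z') \<in> A" "(i', y') \<noteq> (j', z')" "i' \<le> j'"
          "h y' \<le> h z'"
        using \<open>A \<notin> ?H Y\<close> sub by (rule not_prod_antichainsE)
      have "y' \<in> Y" "z' \<in> Y" using ij'(1,2) sub by auto
      then have "y' = b" "z' = a" using D[OF ij'(1,2,4)] ij'(3,5) twin_h[of y' z'] by auto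
      with ij' have 2: "(i', b) \<in> A" "(j', a) \<in> A" "i' \<le> j'" by auto
      have refl: "twin_le g a b a a" "twin_le g a b b b" using neq by (auto simp: twin_le_def)
      \<comment> \<open>First coordinates are linearly ordered, so \<open>a\<close> occurs only once
        as a second coordinate, and so does \<open>b\<close>.\<close>
      have ii: "k = l" if "(k, y) \<in> A" "(l, y) \<in> A" "y = a \<or> y = b" for k l y
        using D[of k y l y] D[of l y k y] that refl linear[of k l] by blast
      \<comment> \<open>Uniqueness gives \<open>j' = i\<close> and \<open>i' = j\<close>, and the
        two inequalities then close up.\<close>
      have ij: "i = j" using ii[of i a j'] ii[of j b i'] 1 2 by auto
      have ia: "(k, a) \<in> A \<longleftrightarrow> k = i" "(k, b) \<in> A \<longleftrightarrow> k = i" for k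
        using 1 ij ii[of i a k] ii[of j b k] by auto
      let ?B = "A - {(i, b)}"
      have "?B \<subseteq> X \<times> (Y - {b})" using sub ia by auto
      then have "?B \<in> ?P (Y - {b})"
        using D twin_g by (intro prod_antichainsI) blast+
      moreover have "?B \<notin> ?P (Y - {a, b})"
        using 1 neq by (auto dest!: prod_antichains_subset)
      moreover have "?f ?B = A" using ia neq by auto
      ultimately show ?thesis by blast
    qed simp
  next
    fix A assume "A \<in> (?P Y \<union> ?H Y) \<union> ?f ` ?D"
    then consider "A \<in> ?F" | B where "B \<in> ?D" "A = ?f B" using PF HF by blast
    then show "A \<in> ?F"
    proof cases
      case 2
      then have B: "B \<in> ?P (Y - {b})" by simp
      note sub = prod_antichains_subset[OF B] and D = prod_antichainsD[OF B]
      show ?thesis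
      proof (rule prod_antichainsI)
        show "A \<subseteq> X \<times> Y" using 2 sub b by auto
        fix i y j z assume *: "(i, y) \<in> A" "(j, z) \<in> A" "(i, y) \<noteq> (j, z)" "i \<le> j"
        \<comment> \<open>Replacing \<open>b\<close> by \<open>a\<close> maps \<open>A\<close> into
          \<open>B\<close> and preserves comparability, so a comparable pair in \<open>A\<close>
          collapses to one point of \<open>B\<close>. It could only be \<open>(i, a)\<close> and
          \<open>(i, b)\<close>, which the twin order leaves incomparable.\<close>
        let ?t = "\<lambda>y. if y = b then a else y"
        have t: "(i, ?t y) \<in> B" "(j, ?t z) \<in> B" "y \<in> Y" "z \<in> Y" using * 2 sub b by auto
        show "\<not> twin_le g a b y z"
        proof
          assume le: "twin_le g a b y z"
          have "g (?t y) \<le> g (?t z)"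
            using le twin[OF t(3)] twin[OF t(4)] by (auto simp: twin_le_def)
          then have "i = j" "?t y = ?t z" using D[OF t(1,2) *(4)] by auto
          then show False using * le neq ab by (auto simp: twin_le_def split: if_splits)
        qed
      qed
    qed
  qed
  have D_a: thesis if "A \<in> ?D" "\<And>i. (i, a) \<in> A \<Longrightarrow> thesis" for A thesis
  proof -
    have "A \<subseteq> X \<times> (Y - {b})" "\<not> A \<subseteq> X \<times> (Y - {a, b})"
      using that(1) by (auto simp: prod_antichains_def)
    then show thesis using that(2) by blast
  qed
  have disj: "(?P Y \<union> ?H Y) \<inter> ?f ` ?D = {}"
  proof -
    \<comment> \<open>The set contains \<open>(i, a)\<close> and \<open>(i, b)\<close> for a common
      \<open>i\<close>, which are comparable in both linear extensions.\<close>
    have "?f B \<notin> ?P Y \<union> ?H Y" if B: "B \<in> ?D" for B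
    proof -
      obtain i where "(i, a) \<in> B" using B by (rule D_a)
      then have "(i, a) \<in> ?f B" "(i, b) \<in> ?f B" by auto
      then show ?thesis
        using prod_antichainsD[of "?f B" "rank_le g" X Y i a i b]
          prod_antichainsD[of "?f B" "rank_le h" X Y i b i a] hab neq by blast
    qed
    then show ?thesis by blast
  qed
  have "card_poly (?f ` ?D) = pCons 0 (card_poly ?D)"
  proof (rule card_poly_image_Suc)
    show "inj_on ?f ?D" by (rule inj_on_inverseI) (rule f_inter)
    fix A assume A: "A \<in> ?D"
    then have P: "A \<in> ?P (Y - {b})" by simp
    note sub = prod_antichains_subset[OF P] and D = prod_antichainsD[OF P]
    obtain i where i: "(i, a) \<in> A" using A by (rule D_a)
    \<comment> \<open>Since \<open>a\<close> is used exactly once, \<open>?f\<close> adds a single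
      element.\<close>
    have "k = i" if "(k, a) \<in> A" for k
      using D[OF that i] D[OF i that] linear[of k i] by blast
    with i have "{i. (i, a) \<in> A} = {i}" by blast
    then have "?f A = insert (i, b) A" by auto
    moreover have "(i, b) \<notin> A" using sub by auto
    ultimately show "card (?f A) = Suc (card A)"
      using finite_of_prod_antichains[OF P X] Y by auto
  qed
  moreover have "?P (Y - {a, b}) \<subseteq> ?P (Y - {b})" by (rule prod_antichains_mono) auto
  moreover have "?P (Y - {a}) \<inter> ?P (Y - {b}) = ?P (Y - {a, b})"
    unfolding prod_antichains_Int by (intro arg_cong2[where f = "prod_antichains _"]) auto
  \<comment> \<open>The parenthesis is the polynomial of the common antichains of the two linear
    extensions. The index shift of \<open>pCons 0\<close> causes the case distinction at
    \<open>k = 0\<close> in the claim.\<close>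
  ultimately have eq: "card_poly ?F = card_poly (?P Y) + card_poly (?H Y)
    - (card_poly (?P (Y - {a})) + card_poly (?P (Y - {b})) - card_poly (?P (Y - {a, b})))
    + pCons 0 (card_poly (?P (Y - {b})) - card_poly (?P (Y - {a, b})))"
    unfolding F using disj PH
    by (simp add: card_poly_Un_disjoint card_poly_Un card_poly_Diff)
  have card: "card (Y - {a}) = c + 1" "card (Y - {b}) = c + 1" "card (Y - {a, b}) = c"
    using cY a b neq Y by (simp_all add: card_Diff_subset)
  have coeff: "coeff (card_poly (?P Z)) k = prod_chains_coeff (card X) (card Z) k" if "Z \<subseteq> Y" for Z k
    using that Y X g
    by (intro coeff_card_poly_rank) (auto intro: finite_subset inj_on_subset)
  have coeff_h: "coeff (card_poly (?H Y)) k = prod_chains_coeff (card X) (card Y) k" for k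
    using Y X h by (intro coeff_card_poly_rank)
  show ?thesis
    unfolding eq by (cases k) (simp_all add: coeff coeff_h card cY)
qed

section \<open>Relational posets and the structure of \<open>poset_K\<close>\<close>

lemma Field_natLeq_on: "Field (natLeq_on m) = {..<m}"
  by (auto simp: Field_def)

text \<open>Antichains compare only elements of the field, so \<open>s\<close> may be replaced by
  any comparison that agrees with it there, in particular one defined by ranks.\<close>

lemma antichain_poly_prod_natLeq_on:
  assumes s: "Partial_order s"
    and le: "\<And>y z. y \<in> Field s \<Longrightarrow> z \<in> Field s \<Longrightarrow> (y, z) \<in> s \<longleftrightarrow> le y z"
  shows "antichain_poly (natLeq_on m \<times>\<^sub>P s) = card_poly (prod_antichains le {..<m} (Field s))"
proof -
  have "(p, q) \<in> natLeq_on m \<times>\<^sub>P s \<longleftrightarrow> fst p \<le> fst q \<and> le (snd p) (snd q)"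
    if "p \<in> {..<m} \<times> Field s" "q \<in> {..<m} \<times> Field s" for p q
    using that le by (cases p; cases q) auto
  then have "antichain (natLeq_on m \<times>\<^sub>P s) A \<longleftrightarrow> A \<in> prod_antichains le {..<m} (Field s)" for A
    unfolding antichain_def prod_antichains_def
      Field_poset_prod[OF Partial_order_natLeq_on s] Field_natLeq_on
    by blast
  then show ?thesis by (simp add: antichain_poly_def card_poly_def)
qed

text \<open>A linear extension of \<open>poset_K n\<close>: the incomparable pair gets the
  consecutive ranks \<open>n\<close> and \<open>n + 1\<close>, and the upper chain starts at
  \<open>n + 2\<close>.\<close>

fun K_rank :: "nat \<Rightarrow> (nat + (nat + nat)) + nat \<Rightarrow> nat"
  where
    "K_rank n (Inl (Inl i)) = i"
  | "K_rank n (Inl (Inr (Inl i))) = n"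
  | "K_rank n (Inl (Inr (Inr i))) = Suc n"
  | "K_rank n (Inr i) = n + 2 + i"

lemma Field_poset_K_middle: "Field (natLeq_on k \<squnion>\<^sub>P natLeq_on l) = {..<k} <+> {..<l}"
  by (simp only: Field_disjoint_union[OF Partial_order_natLeq_on Partial_order_natLeq_on]
      Field_natLeq_on)

lemma Field_poset_K_lower:
  "Field (natLeq_on n \<oplus>\<^sub>P (natLeq_on k \<squnion>\<^sub>P natLeq_on l)) = {..<n} <+> ({..<k} <+> {..<l})"
  by (subst Field_ordinal_sum)
    (intro Partial_order_disjoint_union Partial_order_natLeq_on
      | simp only: Field_poset_K_middle Field_natLeq_on)+

lemma Field_poset_K: "Field (poset_K n) = ({..<n} <+> ({..<1} <+> {..<1})) <+> {..<n}"
  unfolding poset_K_def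
  by (subst Field_ordinal_sum)
    (intro Partial_order_disjoint_union Partial_order_ordinal_sum Partial_order_natLeq_on
      | simp only: Field_poset_K_lower Field_natLeq_on)+

text \<open>Ranks increase along both ordinal sums and within the chains, so the order by rank
  differs from \<open>poset_K n\<close> only in placing one middle element below the other, the
  relation that \<open>twin_le\<close> deletes.\<close>

lemma poset_K_iff:
  assumes "y \<in> Field (poset_K n)" "z \<in> Field (poset_K n)"
  shows "(y, z) \<in> poset_K n \<longleftrightarrow> twin_le (K_rank n) (Inl (Inr (Inl 0))) (Inl (Inr (Inr 0))) y z"
  using assms unfolding Field_poset_K
  by (auto simp: twin_le_def poset_K_def Field_poset_K_middle Field_poset_K_lower Field_natLeq_on
      simp del: less_one less_Suc0 One_nat_def)

section \<open>Comparison of coefficients with the Narayana polynomials\<close>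

lemma sum_monom_eqI:
  assumes "\<And>k. coeff p k = f k" "\<And>k. k > n \<Longrightarrow> f k = 0"
  shows "p = (\<Sum>i\<le>n. monom (f i) i)"
  using assms by (intro poly_eqI) (auto simp: coeff_sum)

theorem mainTheorem3:
  fixes n :: nat
  assumes "n \<ge> 1"
  shows "antichain_poly (natLeq_on n \<times>\<^sub>P natLeq_on n) = Cat_B n
    \<and> antichain_poly (natLeq_on (2 * n + 1) \<times>\<^sub>P poset_K n) = Cat_D (2 * n + 2)"
proof
  have "antichain_poly (natLeq_on n \<times>\<^sub>P natLeq_on n) =
    card_poly (prod_antichains (rank_le id) {..<n} {..<n})"
    by (subst antichain_poly_prod_natLeq_on[OF Partial_order_natLeq_on, where le = "rank_le id"])
      (auto simp: Field_natLeq_on)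
  then show "antichain_poly (natLeq_on n \<times>\<^sub>P natLeq_on n) = Cat_B n"
    unfolding Cat_B_def
    by (intro sum_monom_eqI) (simp_all add: coeff_card_poly_rank power2_eq_square)
next
  let ?Y = "Field (poset_K n)"
  let ?a = "Inl (Inr (Inl 0)) :: (nat + (nat + nat)) + nat"
  let ?b = "Inl (Inr (Inr 0)) :: (nat + (nat + nat)) + nat"
  have inj: "inj_on (K_rank n) ?Y"
    unfolding Field_poset_K by (auto simp: inj_on_def)
  have Y: "finite ?Y" "?a \<in> ?Y" "?b \<in> ?Y" "card ?Y = Suc (Suc (2 * n))"
    unfolding Field_poset_K by (auto simp: card_Plus)
  note coeff = coeff_card_poly_twin[OF Y(1) _ inj Y(2,3) _ Y(4), simplified]
  have eq: "antichain_poly (natLeq_on (2 * n + 1) \<times>\<^sub>P poset_K n) =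
    card_poly (prod_antichains (twin_le (K_rank n) ?a ?b) {..<2 * n + 1} ?Y)"
    by (intro antichain_poly_prod_natLeq_on Partial_order_poset_K poset_K_iff)
  show "antichain_poly (natLeq_on (2 * n + 1) \<times>\<^sub>P poset_K n) = Cat_D (2 * n + 2)"
    unfolding Cat_D_def eq
  proof (rule sum_monom_eqI)
    fix k
    \<comment> \<open>For \<open>c = 2 * n\<close> the chain length is \<open>c + 1\<close>, so only
      the upper indices \<open>c\<close>, \<open>c + 1\<close>, \<open>c + 2\<close> occur and
      Pascal's rule relates them. The values 0 and 1 are separate because terms with lower index
      \<open>k - 1\<close> or \<open>k - 2\<close> are zero there instead of truncating.\<close>
    consider "k = 0" | "k = 1" | j where "k = Suc (Suc j)"
      by (metis One_nat_def not0_implies_Suc)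
    then show "coeff (card_poly (prod_antichains (twin_le (K_rank n) ?a ?b) {..<2 * n + 1} ?Y)) k =
      int (((2 * n + 2) choose k) * (((2 * n + 2 - 1) choose k)
        + (if k < 2 then 0 else (2 * n + 2 - 2) choose (k - 2))))"
      by cases (simp_all add: coeff algebra_simps)
  qed (simp add: binomial_eq_0)
qed

end
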